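(* Let $X$ be a topological median algebra with compact intervals, equipped with a continuous action of a topological group $G$ by median automorphisms. Then the canonical extended action $G\times X^{RF}\to X^{RF}$ of $G$ on the Roller--Fioravanti compactification $X^{RF}$ is jointly continuous.
   Context: A median algebra is a set $X$ with a ternary operation $m:X^3\to X$ such that $m$ is invariant under permutations of its arguments, $m(a,b,b)=b$, and $m(m(a,x,b),x,c)=m(a,x,m(b,x,c))$ for all $a,b,c,x\in X$. A topological median algebra is a Hausdorff space with a continuous median operation. Intervals are the sets $[x,y]=\{z\in X: m(x,y,z)=z\}$; $X$ has compact intervals if every $[x,y]$ is compact in the topology of $X$. $G$ acts by median automorphisms if $g\,m(x,y,z)=m(gx,gy,gz)$ for all $g\in G$, $x,y,z\in X$; the action is continuous if $G\times X\to X$ is jointly continuous. Roller--Fioravanti (RF) compactification: for $X$ with compact intervals let $$\nu:X\to\prod_{(x,y)\in X\times X}[x,y],\qquad \nu(z)=(m(x,y,z))_{x,y},$$ with the product topology on the target, and let $X^{RF}$ be the closure of $\nu(X)$. The map $\nu$ is injective, continuous and median-preserving (for the coordinatewise median), and $X^{RF}$ is a compact median algebra. It is the completion of $X$ with respect to the initial uniformity induced by the interval retractions $z\mapsto m(x,y,z)$, $X\to[x,y]$. Canonical extended action: every $g\in G$ extends uniquely to a homeomorphism of $X^{RF}$ such that $g\,\nu(z)=\nu(gz)$ for all $z\in X$ (explicitly $(g\xi)_{x,y}=g\,\xi_{g^{-1}x,g^{-1}y}$); this defines an action of $G$ on $X^{RF}$ by continuous median automorphisms. *)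

theory Defs
  imports "HOL-Analysis.Analysis" "HOL-Algebra.Group_Action"
begin

locale median_algebra =
  fixes X :: "'a set" and m :: "'a \<Rightarrow> 'a \<Rightarrow> 'a \<Rightarrow> 'a"
  assumes median_closed: "\<lbrakk>a \<in> X; b \<in> X; c \<in> X\<rbrakk> \<Longrightarrow> m a b c \<in> X"
    \<comment> \<open>these two transpositions generate all permutations of the arguments\<close>
    and median_swap12: "\<lbrakk>a \<in> X; b \<in> X; c \<in> X\<rbrakk> \<Longrightarrow> m a b c = m b a c"
    and median_swap23: "\<lbrakk>a \<in> X; b \<in> X; c \<in> X\<rbrakk> \<Longrightarrow> m a b c = m a c b"
    and median_majority: "\<lbrakk>a \<in> X; b \<in> X\<rbrakk> \<Longrightarrow> m a b b = b"
    and median_assoc: "\<lbrakk>a \<in> X; b \<in> X; c \<in> X; x \<in> X\<rbrakk> \<Longrightarrow> m (m a x b) x c = m a x (m b x c)"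

definition median_interval :: "'a set \<Rightarrow> ('a \<Rightarrow> 'a \<Rightarrow> 'a \<Rightarrow> 'a) \<Rightarrow> 'a \<Rightarrow> 'a \<Rightarrow> 'a set" where
  "median_interval X m x y = {z \<in> X. m x y z = z}"

locale topological_median_algebra = median_algebra "topspace T" m
  for T :: "'a topology" and m :: "'a \<Rightarrow> 'a \<Rightarrow> 'a \<Rightarrow> 'a" +
  assumes hausdorff: "Hausdorff_space T"
    and continuous_median:
      "continuous_map (prod_topology T (prod_topology T T)) T (\<lambda>(x, y, z). m x y z)"

definition has_compact_intervals :: "'a topology \<Rightarrow> ('a \<Rightarrow> 'a \<Rightarrow> 'a \<Rightarrow> 'a) \<Rightarrow> bool" where
  "has_compact_intervals T m \<longleftrightarrow>
     (\<forall>x\<in>topspace T. \<forall>y\<in>topspace T. compactin T (median_interval (topspace T) m x y))"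

text \<open>No separation axiom is imposed on a topological group.\<close>

locale topological_group = group G
  for G :: "('g, 'r) monoid_scheme" (structure) and TG :: "'g topology" +
  assumes topspace_group: "topspace TG = carrier G"
    and continuous_mult: "continuous_map (prod_topology TG TG) TG (\<lambda>(g, h). g \<otimes> h)"
    and continuous_inv: "continuous_map TG TG (\<lambda>g. inv g)"

locale continuous_median_action = group_action G "topspace T" \<phi>
  for G :: "('g, 'r) monoid_scheme" (structure) and TG :: "'g topology"
    and T :: "'a topology" and m :: "'a \<Rightarrow> 'a \<Rightarrow> 'a \<Rightarrow> 'a" and \<phi> :: "'g \<Rightarrow> 'a \<Rightarrow> 'a" +
  assumes median_equivariant:
      "\<lbrakk>g \<in> carrier G; x \<in> topspace T; y \<in> topspace T; z \<in> topspace T\<rbrakk>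
        \<Longrightarrow> \<phi> g (m x y z) = m (\<phi> g x) (\<phi> g y) (\<phi> g z)"
    and continuous_action: "continuous_map (prod_topology TG T) T (\<lambda>(g, x). \<phi> g x)"

definition interval_product ::
    "'a topology \<Rightarrow> ('a \<Rightarrow> 'a \<Rightarrow> 'a \<Rightarrow> 'a) \<Rightarrow> ('a \<times> 'a \<Rightarrow> 'a) topology" where
  "interval_product T m =
     product_topology (\<lambda>(x, y). subtopology T (median_interval (topspace T) m x y))
       (topspace T \<times> topspace T)"

definition rf_embedding ::
    "'a topology \<Rightarrow> ('a \<Rightarrow> 'a \<Rightarrow> 'a \<Rightarrow> 'a) \<Rightarrow> 'a \<Rightarrow> 'a \<times> 'a \<Rightarrow> 'a" where
  "rf_embedding T m z = restrict (\<lambda>(x, y). m x y z) (topspace T \<times> topspace T)"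

definition rf_compactification ::
    "'a topology \<Rightarrow> ('a \<Rightarrow> 'a \<Rightarrow> 'a \<Rightarrow> 'a) \<Rightarrow> ('a \<times> 'a \<Rightarrow> 'a) topology" where
  "rf_compactification T m =
     subtopology (interval_product T m)
       (interval_product T m closure_of (rf_embedding T m ` topspace T))"

text \<open>
  The explicit formula for the canonical extended action. The lemmas
  \<open>homeomorphic_map_rf_action\<close>, \<open>rf_action_rf_embedding\<close> and \<open>rf_action_unique\<close> below show
  that \<open>rf_action G T m \<phi> g\<close> is the unique homeomorphism of the compactification that extends the
  action of \<open>g\<close>; \<open>group_action_rf_action\<close> shows that these form a group action.
\<close>

definition rf_action ::
    "('g, 'r) monoid_scheme \<Rightarrow> 'a topology \<Rightarrow> ('a \<Rightarrow> 'a \<Rightarrow> 'a \<Rightarrow> 'a) \<Rightarrow> ('g \<Rightarrow> 'a \<Rightarrow> 'a)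
      \<Rightarrow> 'g \<Rightarrow> ('a \<times> 'a \<Rightarrow> 'a) \<Rightarrow> ('a \<times> 'a \<Rightarrow> 'a)" where
  "rf_action G T m \<phi> g =
     (\<lambda>\<xi>\<in>topspace (rf_compactification T m).
       restrict (\<lambda>(x, y). \<phi> g (\<xi> (\<phi> (inv\<^bsub>G\<^esub> g) x, \<phi> (inv\<^bsub>G\<^esub> g) y)))
         (topspace T \<times> topspace T))"

context
  fixes T :: "'a topology" and m G and TG :: "'g topology" and \<phi>
  assumes tma: "topological_median_algebra T m"
    and tg: "topological_group G TG"
    and act: "continuous_median_action G TG T m \<phi>"
begin

interpretation topological_median_algebra T m by (fact tma)
interpretation topological_group G TG by (fact tg)
interpretation continuous_median_action G TG T m \<phi> by (fact act)

private definition formula where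
  "formula g \<xi> = restrict (\<lambda>(x, y). \<phi> g (\<xi> (\<phi> (inv\<^bsub>G\<^esub> g) x, \<phi> (inv\<^bsub>G\<^esub> g) y)))
         (topspace T \<times> topspace T)"

private lemma act_closed: "g \<in> carrier G \<Longrightarrow> x \<in> topspace T \<Longrightarrow> \<phi> g x \<in> topspace T"
  by (rule element_image) auto

private lemma act_inv:
  assumes "g \<in> carrier G" "x \<in> topspace T"
  shows "\<phi> g (\<phi> (inv\<^bsub>G\<^esub> g) x) = x" "\<phi> (inv\<^bsub>G\<^esub> g) (\<phi> g x) = x"
proof -
  have "\<phi> \<one>\<^bsub>G\<^esub> x = x"
    using id_eq_one assms by (metis restrict_apply')
  then show "\<phi> g (\<phi> (inv\<^bsub>G\<^esub> g) x) = x" "\<phi> (inv\<^bsub>G\<^esub> g) (\<phi> g x) = x"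
    using composition_rule[of x g "inv\<^bsub>G\<^esub> g"] composition_rule[of x "inv\<^bsub>G\<^esub> g" g] assms
    by auto
qed

private lemma act_cont: "g \<in> carrier G \<Longrightarrow> continuous_map T T (\<phi> g)"
proof -
  assume g: "g \<in> carrier G"
  have "continuous_map T (prod_topology TG T) (\<lambda>x. (g, x))"
    using g topspace_group by (intro continuous_map_pairedI) auto
  from continuous_map_compose[OF this continuous_action]
  show ?thesis by (simp add: o_def)
qed

private lemma topspace_ip:
  "topspace (interval_product T m) =
    (\<Pi>\<^sub>E (x, y)\<in>topspace T \<times> topspace T. median_interval (topspace T) m x y)"
proof -
  have "topspace T \<inter> median_interval (topspace T) m x y = median_interval (topspace T) m x y"
    for x y by (auto simp: median_interval_def)
  then show ?thesis
    unfolding interval_product_def topspace_product_topology by (intro PiE_cong) auto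
qed

private lemma emb_in:
  assumes "z \<in> topspace T"
  shows "rf_embedding T m z \<in> topspace (interval_product T m)"
proof -
  have "m x y (m x y z) = m x y z" if "x \<in> topspace T" "y \<in> topspace T" for x y
  proof -
    have "m x y z = m y x z" "m x y (m x y z) = m y x (m y x z)"
      using that assms median_swap12 median_closed by metis+
    moreover have "m y x (m y x z) = m (m y x y) x z"
      using median_assoc that assms by metis
    moreover have "m y x y = y"
      using that by (metis median_swap12 median_majority)
    ultimately show ?thesis by simp
  qed
  then show ?thesis
    unfolding topspace_ip using assms
    by (auto simp: rf_embedding_def median_interval_def median_closed)
qed

private lemma topspace_rf:
  "topspace (rf_compactification T m) =
    interval_product T m closure_of (rf_embedding T m ` topspace T)"
  unfolding rf_compactification_def
  by (simp add: closure_of_subset_topspace Int_absorb1)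

private lemma emb_rf:
  "z \<in> topspace T \<Longrightarrow> rf_embedding T m z \<in> topspace (rf_compactification T m)"
proof -
  have "rf_embedding T m ` topspace T \<subseteq> topspace (interval_product T m)"
    using emb_in by auto
  then show "z \<in> topspace T \<Longrightarrow> rf_embedding T m z \<in> topspace (rf_compactification T m)"
    unfolding topspace_rf using closure_of_subset by blast
qed

private lemma formula_cont_ip:
  assumes g: "g \<in> carrier G"
  shows "continuous_map (interval_product T m) (interval_product T m) (formula g)"
proof -
  let ?h = "inv\<^bsub>G\<^esub> g"
  have h: "?h \<in> carrier G" using g by simp
  have "continuous_map (interval_product T m)
      (subtopology T (median_interval (topspace T) m x y)) (\<lambda>\<xi>. formula g \<xi> (x, y))"
    if x: "x \<in> topspace T" and y: "y \<in> topspace T" for x y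
  proof -
    let ?x = "\<phi> ?h x" and ?y = "\<phi> ?h y"
    have xy: "?x \<in> topspace T" "?y \<in> topspace T" using act_closed h x y by auto
    have "continuous_map (interval_product T m)
        (case (?x, ?y) of (x, y) \<Rightarrow> subtopology T (median_interval (topspace T) m x y))
        (\<lambda>\<xi>. \<xi> (?x, ?y))"
      unfolding interval_product_def
      by (rule continuous_map_product_projection) (use xy in auto)
    then have 1: "continuous_map (interval_product T m) T (\<lambda>\<xi>. \<xi> (?x, ?y))"
      by (simp add: continuous_map_in_subtopology)
    have 2: "continuous_map (interval_product T m) T (\<lambda>\<xi>. \<phi> g (\<xi> (?x, ?y)))"
      using continuous_map_compose[OF 1 act_cont[OF g]] by (simp add: o_def)
    have "\<phi> g (\<xi> (?x, ?y)) \<in> median_interval (topspace T) m x y"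
      if "\<xi> \<in> topspace (interval_product T m)" for \<xi>
    proof -
      let ?w = "\<xi> (?x, ?y)"
      have w: "?w \<in> topspace T" "m ?x ?y ?w = ?w"
        using that xy unfolding topspace_ip by (auto simp: median_interval_def PiE_iff)
      then have "\<phi> g ?w = m (\<phi> g ?x) (\<phi> g ?y) (\<phi> g ?w)"
        using median_equivariant[OF g xy w(1)] by simp
      then show ?thesis
        using act_inv[OF g] x y w act_closed[OF g] by (simp add: median_interval_def)
    qed
    then show ?thesis
      using 2 x y by (auto simp: continuous_map_in_subtopology formula_def)
  qed
  then have "continuous_map (interval_product T m)
      (product_topology (\<lambda>(x, y). subtopology T (median_interval (topspace T) m x y))
        (topspace T \<times> topspace T)) (formula g)"
    unfolding continuous_map_componentwise by (auto simp: formula_def)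
  then show ?thesis by (simp add: interval_product_def)
qed

private lemma formula_emb:
  assumes g: "g \<in> carrier G" and z: "z \<in> topspace T"
  shows "formula g (rf_embedding T m z) = rf_embedding T m (\<phi> g z)"
proof -
  have "\<phi> g (m (\<phi> (inv\<^bsub>G\<^esub> g) x) (\<phi> (inv\<^bsub>G\<^esub> g) y) z) = m x y (\<phi> g z)"
    if "x \<in> topspace T" "y \<in> topspace T" for x y
    using median_equivariant[OF g] act_closed act_inv[OF g] that z g by simp
  then show ?thesis
    using act_closed g by (auto simp: formula_def rf_embedding_def restrict_def fun_eq_iff)
qed

private lemma rf_action_eq:
  "\<xi> \<in> topspace (rf_compactification T m) \<Longrightarrow> rf_action G T m \<phi> g \<xi> = formula g \<xi>"
  by (simp add: rf_action_def formula_def)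

lemma rf_action_rf_embedding:
  assumes "g \<in> carrier G" "z \<in> topspace T"
  shows "rf_action G T m \<phi> g (rf_embedding T m z) = rf_embedding T m (\<phi> g z)"
  using assms by (simp add: rf_action_eq emb_rf formula_emb)

private lemma rf_action_cont:
  assumes g: "g \<in> carrier G"
  shows "continuous_map (rf_compactification T m) (rf_compactification T m) (rf_action G T m \<phi> g)"
proof -
  let ?C = "interval_product T m closure_of (rf_embedding T m ` topspace T)"
  have "formula g ` ?C \<subseteq> interval_product T m closure_of (formula g ` (rf_embedding T m ` topspace T))"
    using continuous_map_image_closure_subset[OF formula_cont_ip[OF g]] by blast
  also have "\<dots> \<subseteq> ?C"
    by (rule closure_of_mono) (use formula_emb[OF g] act_closed[OF g] in auto)
  finally have "continuous_map (rf_compactification T m) (rf_compactification T m) (formula g)"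
    unfolding rf_compactification_def
    using formula_cont_ip[OF g]
    by (auto simp: continuous_map_in_subtopology continuous_map_from_subtopology)
  then show ?thesis
    using continuous_map_eq rf_action_eq by metis
qed

private lemma formula_mult:
  assumes g: "g \<in> carrier G" and h: "h \<in> carrier G"
    and \<xi>: "\<xi> \<in> topspace (interval_product T m)"
  shows "formula (g \<otimes>\<^bsub>G\<^esub> h) \<xi> = formula g (formula h \<xi>)"
proof
  fix p
  show "formula (g \<otimes>\<^bsub>G\<^esub> h) \<xi> p = formula g (formula h \<xi>) p"
  proof (cases "p \<in> topspace T \<times> topspace T")
    case False
    then show ?thesis unfolding formula_def by (simp only: restrict_apply if_False)
  next
    case True
    then obtain x y where p: "p = (x, y)" "x \<in> topspace T" "y \<in> topspace T" by auto
    let ?x = "\<phi> (inv\<^bsub>G\<^esub> h) (\<phi> (inv\<^bsub>G\<^esub> g) x)" and ?y = "\<phi> (inv\<^bsub>G\<^esub> h) (\<phi> (inv\<^bsub>G\<^esub> g) y)"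
    have xy: "?x \<in> topspace T" "?y \<in> topspace T"
      using p g h by (auto intro!: act_closed)
    have "\<xi> (?x, ?y) \<in> topspace T"
      using \<xi> xy unfolding topspace_ip by (auto simp: median_interval_def PiE_iff)
    then show ?thesis
      using p g h act_closed composition_rule
      by (simp add: formula_def inv_mult_group)
  qed
qed

private lemma in_ip: "\<xi> \<in> topspace (rf_compactification T m) \<Longrightarrow> \<xi> \<in> topspace (interval_product T m)"
  unfolding rf_compactification_def by simp

private lemma rf_action_closed:
  "g \<in> carrier G \<Longrightarrow> \<xi> \<in> topspace (rf_compactification T m) \<Longrightarrow>
    rf_action G T m \<phi> g \<xi> \<in> topspace (rf_compactification T m)"
  using continuous_map_image_subset_topspace[OF rf_action_cont] by auto

private lemma rf_action_mult:
  assumes "g \<in> carrier G" "h \<in> carrier G" "\<xi> \<in> topspace (rf_compactification T m)"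
  shows "rf_action G T m \<phi> (g \<otimes>\<^bsub>G\<^esub> h) \<xi> = rf_action G T m \<phi> g (rf_action G T m \<phi> h \<xi>)"
  using assms rf_action_closed[OF assms(2,3)]
  by (simp add: rf_action_eq formula_mult in_ip)

private lemma rf_action_one:
  assumes "\<xi> \<in> topspace (rf_compactification T m)"
  shows "rf_action G T m \<phi> \<one>\<^bsub>G\<^esub> \<xi> = \<xi>"
proof -
  have id: "\<phi> \<one>\<^bsub>G\<^esub> x = x" if "x \<in> topspace T" for x
    using id_eq_one that by (metis restrict_apply')
  have \<xi>: "\<xi> \<in> (\<Pi>\<^sub>E (x, y)\<in>topspace T \<times> topspace T. median_interval (topspace T) m x y)"
    using in_ip[OF assms] unfolding topspace_ip .
  have "formula \<one>\<^bsub>G\<^esub> \<xi> p = \<xi> p" for p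
  proof (cases "p \<in> topspace T \<times> topspace T")
    case True
    then obtain x y where p: "p = (x, y)" "x \<in> topspace T" "y \<in> topspace T" by auto
    then have "\<xi> (x, y) \<in> topspace T" using \<xi> by (auto simp: median_interval_def PiE_iff)
    then show ?thesis using p id by (simp add: formula_def)
  next
    case False
    then have "\<xi> p = undefined" using \<xi> by (rule PiE_arb[rotated])
    then show ?thesis using False unfolding formula_def by (simp only: restrict_apply if_False)
  qed
  then show ?thesis using assms rf_action_eq by auto
qed

lemma homeomorphic_map_rf_action:
  assumes "g \<in> carrier G"
  shows "homeomorphic_map (rf_compactification T m) (rf_compactification T m) (rf_action G T m \<phi> g)"
proof -
  have "homeomorphic_maps (rf_compactification T m) (rf_compactification T m)
      (rf_action G T m \<phi> g) (rf_action G T m \<phi> (inv\<^bsub>G\<^esub> g))"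
    unfolding homeomorphic_maps_def
    using assms rf_action_cont rf_action_mult[symmetric] rf_action_one by simp
  then show ?thesis by (rule homeomorphic_maps_imp_map)
qed

lemma rf_action_unique:
  assumes "g \<in> carrier G"
    and h: "continuous_map (rf_compactification T m) (rf_compactification T m) h"
    and ext: "\<And>z. z \<in> topspace T \<Longrightarrow> h (rf_embedding T m z) = rf_embedding T m (\<phi> g z)"
    and \<xi>: "\<xi> \<in> topspace (rf_compactification T m)"
  shows "h \<xi> = rf_action G T m \<phi> g \<xi>"
proof (rule forall_in_closure_of_eq[OF _ _ h rf_action_cont[OF assms(1)]])
  show "\<xi> \<in> rf_compactification T m closure_of (rf_embedding T m ` topspace T)"
    using \<xi> emb_rf unfolding topspace_rf unfolding rf_compactification_def
    by (subst closure_of_subtopology) (auto simp: topspace_rf[unfolded rf_compactification_def] Int_absorb1 image_subset_iff)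
  have "Hausdorff_space (interval_product T m)"
    unfolding interval_product_def
    using hausdorff by (auto simp: Hausdorff_space_product_topology Hausdorff_space_subtopology)
  then show "Hausdorff_space (rf_compactification T m)"
    unfolding rf_compactification_def by (rule Hausdorff_space_subtopology)
qed (use ext rf_action_rf_embedding assms(1) in auto)

lemma group_action_rf_action:
  "group_action G (topspace (rf_compactification T m)) (rf_action G T m \<phi>)"
proof -
  let ?E = "topspace (rf_compactification T m)"
  have B: "rf_action G T m \<phi> g \<in> Bij ?E" if "g \<in> carrier G" for g
    using homeomorphic_imp_injective_map[OF homeomorphic_map_rf_action[OF that]]
      homeomorphic_imp_surjective_map[OF homeomorphic_map_rf_action[OF that]]
    by (simp add: Bij_def bij_betw_def) (simp add: rf_action_def)
  have "rf_action G T m \<phi> \<in> hom G (BijGroup ?E)"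
  proof (rule homI)
    fix g h assume gh: "g \<in> carrier G" "h \<in> carrier G"
    show "rf_action G T m \<phi> (g \<otimes>\<^bsub>G\<^esub> h) = rf_action G T m \<phi> g \<otimes>\<^bsub>BijGroup ?E\<^esub> rf_action G T m \<phi> h"
    proof
      fix \<xi>
      show "rf_action G T m \<phi> (g \<otimes>\<^bsub>G\<^esub> h) \<xi> =
          (rf_action G T m \<phi> g \<otimes>\<^bsub>BijGroup ?E\<^esub> rf_action G T m \<phi> h) \<xi>"
        using B[OF gh(1)] B[OF gh(2)] rf_action_mult[OF gh]
        by (cases "\<xi> \<in> ?E") (auto simp: BijGroup_def compose_def rf_action_def)
    qed
  qed (use B in \<open>auto simp: BijGroup_def\<close>)
  then show ?thesis
    by (simp add: group_action_def group_hom_def group_hom_axioms_def group_BijGroup is_group)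
qed

end

end

theory Submission
  imports Defs
begin

text \<open>
  In a median algebra, each retraction \<open>m a b\<close> preserves betweenness and hence is a median
  homomorphism. This identity passes to the closure: every \<open>\<xi>\<close> in the compactification satisfies
  \<open>m a b \<xi>\<^bsub>c,d\<^esub> = m (m a b c) (m a b d) \<xi>\<^bsub>a,b\<^esub>\<close>. Consequently, \<open>w \<in> [x, y]\<close> equals \<open>(g \<xi>)\<^bsub>x,y\<^esub>\<close>
  exactly when \<open>m a b (g\<inverse> w) = m (m a b (g\<inverse> x)) (m a b (g\<inverse> y)) \<xi>\<^bsub>a,b\<^esub>\<close> for all
  \<open>a\<close>, \<open>b\<close>. Each of these equations involves only the fixed coordinate \<open>(a, b)\<close> of \<open>\<xi>\<close> and is thus a
  closed condition on \<open>(g, \<xi>, w)\<close>. So the coordinate map \<open>(g, \<xi>) \<mapsto> (g \<xi>)\<^bsub>x,y\<^esub>\<close> has closed graph,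
  and it takes values in the compact interval \<open>[x, y]\<close>; hence it is continuous.
\<close>

section \<open>Betweenness in median algebras\<close>

context median_algebra
begin

abbreviation "I \<equiv> median_interval X m"

lemma interval_iff: "z \<in> I x y \<longleftrightarrow> z \<in> X \<and> m x y z = z"
  by (simp add: median_interval_def)

lemma interval_closed: "z \<in> I x y \<Longrightarrow> z \<in> X"
  by (simp add: interval_iff)

lemma interval_commute: "x \<in> X \<Longrightarrow> y \<in> X \<Longrightarrow> I x y = I y x"
  by (auto simp: interval_iff median_swap12)

lemma median_rotate: "a \<in> X \<Longrightarrow> b \<in> X \<Longrightarrow> c \<in> X \<Longrightarrow> m a b c = m b c a"
  using median_swap12 median_swap23 by metis

lemma median_in_interval12:
  assumes "x \<in> X" "y \<in> X" "z \<in> X"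
  shows "m x y z \<in> I x y"
proof -
  have "m y x (m y x z) = m (m y x y) x z"
    using assms median_assoc by metis
  also have "\<dots> = m y x z"
    using assms by (metis median_swap12 median_majority)
  finally show ?thesis
    using assms by (simp add: interval_iff median_closed median_swap12[of x y])
qed

lemma median_in_interval23: "x \<in> X \<Longrightarrow> y \<in> X \<Longrightarrow> z \<in> X \<Longrightarrow> m x y z \<in> I y z"
  using median_in_interval12[of y z x] by (simp add: median_rotate[of x y z])

lemma median_in_interval13: "x \<in> X \<Longrightarrow> y \<in> X \<Longrightarrow> z \<in> X \<Longrightarrow> m x y z \<in> I x z"
  using median_in_interval12[of x z y] by (simp add: median_swap23[of x y z])

lemmas median_in_interval = median_in_interval12 median_in_interval23 median_in_interval13

text \<open>With \<open>x\<close> as base point, \<open>p \<in> I x q\<close> reads as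
  \<open>p \<le> q\<close>. Both hypotheses evaluate the same median of \<open>x\<close>,
  \<open>p\<close>, \<open>q\<close>.\<close>

lemma interval_antisym:
  "x \<in> X \<Longrightarrow> p \<in> I x q \<Longrightarrow> q \<in> I x p \<Longrightarrow> p = q"
  by (metis interval_iff median_swap23)

text \<open>In the order based at \<open>x\<close>, the point \<open>m p x q\<close> is the meet of
  \<open>p\<close> and \<open>q\<close>: associativity moves the bracket onto
  \<open>m w x p = w\<close>.\<close>

lemma median_greatest:
  assumes "x \<in> X" "p \<in> X" "q \<in> X" "w \<in> I x p" "w \<in> I x q"
  shows "w \<in> I x (m p x q)"
proof -
  have w: "w \<in> X" "m w x p = w" "m w x q = w"
    using assms by (metis interval_iff median_rotate)+
  have "m w x (m p x q) = m (m w x p) x q"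
    using assms w median_assoc by metis
  then have "m w x (m p x q) = w" using w by simp
  then show ?thesis
    using assms w by (metis interval_iff median_rotate median_closed)
qed

lemma interval_trans:
  assumes "x \<in> X" "r \<in> X" "p \<in> I x q" "q \<in> I x r"
  shows "p \<in> I x r"
proof -
  have q: "q \<in> X" "p \<in> X" "m p x q = p" "m q x r = q"
    using assms by (metis interval_iff median_rotate)+
  have "m p x (m q x r) = m (m p x q) x r"
    using assms q median_assoc by metis
  then have "m p x r = p" using q by simp
  then show ?thesis
    using assms q by (metis interval_iff median_rotate)
qed

lemma interval_shift:
  assumes "x \<in> X" "r \<in> X" "p \<in> I x q" "q \<in> I x r"
  shows "q \<in> I p r"
proof -
  have q: "q \<in> X" "p \<in> X" "m x q p = p" "m r q x = q"
    using assms by (metis interval_iff median_rotate median_swap12)+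
  have "m (m r q x) q p = m r q (m x q p)"
    using assms q median_assoc by metis
  then have "m r q p = q" using q by (metis median_majority median_rotate)
  then show ?thesis
    using assms q by (metis interval_iff median_rotate median_swap12)
qed

text \<open>Seen from \<open>a\<close> and also from \<open>b\<close>, \<open>w\<close> lies below
  the median, which is the meet in both orders. As the median lies in \<open>I a b\<close>,
  \<open>interval_shift\<close> turns the relation at \<open>a\<close> into the reverse relation at
  \<open>b\<close>, and antisymmetry applies.\<close>

lemma median_unique:
  assumes "a \<in> X" "b \<in> X" "c \<in> X" "w \<in> I a b" "w \<in> I b c" "w \<in> I a c"
  shows "w = m a b c"
proof -
  have "w \<in> X" using assms interval_closed by blast
  have 1: "w \<in> I a (m b a c)" using median_greatest assms by blast
  have 2: "w \<in> I b (m a b c)" using median_greatest assms interval_commute by blast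
  have p: "m b a c \<in> I a b"
    using median_in_interval12[of b a c] assms interval_commute[of a b] by simp
  have "m b a c = m a b c" using assms by (simp add: median_swap12)
  moreover have "m b a c \<in> I w b"
    using interval_shift[OF assms(1,2) 1 p] .
  ultimately show ?thesis
    using 2 assms interval_antisym[of b w "m a b c"] interval_commute \<open>w \<in> X\<close> by metis
qed

section \<open>Gates of intervals and the retractions onto them\<close>

lemma gate:
  assumes X: "a \<in> X" "b \<in> X" "v \<in> X" and u: "u \<in> I a b"
  shows "m a b v \<in> I v u"
proof -
  note [simp] = median_closed
  note c = interval_commute
  have uX: "u \<in> X" using u interval_closed by blast
  \<comment> \<open>With \<open>v\<close> as base point, \<open>m p v q\<close> is the meet of \<open>p\<close> and \<open>q\<close>, so \<open>w\<close> is the meet of \<open>a\<close> and \<open>b\<close>, and the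
    claim says that \<open>w\<close> lies below \<open>u\<close>, i.e. equals \<open>t\<close>. To this end, \<open>t\<close> is shown to lie in \<open>I a b\<close>.\<close>
  define w where "w = m a b v"
  define a' where "a' = m a v u"
  define b' where "b' = m b v u"
  define t where "t = m w v u"
  have wX: "w \<in> X" and aX: "a' \<in> X" and bX: "b' \<in> X" and tX: "t \<in> X"
    using X uX by (auto simp: w_def a'_def b'_def t_def)
  have t1: "t \<in> I v w" "t \<in> I v u"
    using median_in_interval wX X uX c unfolding t_def by metis+
  have w1: "w \<in> I v a" "w \<in> I v b" "w \<in> I a b"
    using median_in_interval X c unfolding w_def by metis+
  have wt: "w \<in> I t a" "w \<in> I t b"
    using interval_shift[of v] t1(1) w1 X by blast+
  have ta: "t \<in> I v a'" and tb: "t \<in> I v b'"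
    using median_greatest[of v a u t] median_greatest[of v b u t] interval_trans[OF _ _ t1(1)] w1 t1 X uX
    unfolding a'_def b'_def by blast+
  have a1: "a' \<in> I a u" "a' \<in> I v u" "a' \<in> I v a" and b1: "b' \<in> I b u" "b' \<in> I v u" "b' \<in> I v b"
    using median_in_interval X uX c unfolding a'_def b'_def by metis+
  \<comment> \<open>The points \<open>a\<close>, \<open>a'\<close>, \<open>u\<close>,
    \<open>b'\<close>, \<open>b\<close> lie in this order along \<open>I a b\<close>.\<close>
  have ab: "a' \<in> I a b" and ub: "u \<in> I a' b"
    using interval_trans[OF X(1,2) a1(1) u] interval_shift[OF X(1,2) a1(1) u] .
  have ub': "u \<in> I b a'" using ub c aX X by blast
  have ba': "b' \<in> I b a'" and uba: "u \<in> I b' a'"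
    using interval_trans[OF X(2) aX b1(1) ub'] interval_shift[OF X(2) aX b1(1) ub'] .
  \<comment> \<open>In the order based at \<open>v\<close>, the meet of \<open>a\<close>,
    \<open>b\<close> and \<open>u\<close> is also the meet of \<open>a'\<close> and
    \<open>b'\<close>.\<close>
  have "t = m a' v b'"
  proof (rule interval_antisym[OF X(3)])
    show "t \<in> I v (m a' v b')" using median_greatest ta tb X aX bX by blast
    let ?s = "m a' v b'"
    have s: "?s \<in> I v a'" "?s \<in> I v b'"
      using median_in_interval X aX bX c by metis+
    have "?s \<in> I v a" "?s \<in> I v b" "?s \<in> I v u"
      using s interval_trans X uX a1 b1 by blast+
    then have "?s \<in> I v (m a v b)" "?s \<in> I v u"
      using median_greatest X by blast+
    moreover have "m a v b = w" using X median_swap23 w_def by metis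
    ultimately show "?s \<in> I v t"
      unfolding t_def using median_greatest X wX uX by blast
  qed
  then have tab: "t \<in> I a' b'" using median_in_interval X aX bX by blast
  \<comment> \<open>Enlarges \<open>I a' b'\<close> to \<open>I a b\<close>, replacing first the
    endpoint \<open>a'\<close> by \<open>a\<close> and then \<open>b'\<close> by
    \<open>b\<close>.\<close>
  have "b' \<in> I a' b" "a' \<in> I b a"
    using ba' ab c X aX by blast+
  then have "a' \<in> I b' a"
    using interval_shift[of b a b' a'] ba' X by blast
  then have "t \<in> I b' a" "a' \<in> I t a"
    using interval_trans[of b' a t a'] interval_shift[of b' a t a'] tab c aX bX X by blast+
  moreover have "b' \<in> I a b"
    using interval_trans[of b a b' a'] ba' ab c X by blast
  ultimately have tI: "t \<in> I a b"
    using interval_trans[of a b t b'] c X bX by blast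
  \<comment> \<open>Since \<open>w\<close> lies between \<open>a\<close> and \<open>t\<close>, the
    point \<open>t\<close> lies between \<open>w\<close> and \<open>b\<close>; but \<open>w\<close>
    also lies between \<open>t\<close> and \<open>b\<close>.\<close>
  have "w \<in> I a t" "w \<in> I b t" using wt c X tX by blast+
  then have "t \<in> I w b" using interval_shift[of a b w t] tI X by blast
  then have "t = w"
    using interval_antisym[of b t w] \<open>w \<in> I b t\<close> c X wX by blast
  then show ?thesis using t1 w_def by simp
qed

text \<open>By \<open>gate\<close>, seen from \<open>v\<close>, the point \<open>m a b v\<close>
  lies below \<open>u\<close> and below \<open>p\<close>, hence below their meet, which is
  \<open>v\<close> itself.\<close>

lemma interval_convex:
  assumes X: "a \<in> X" "b \<in> X" and u: "u \<in> I a b" and p: "p \<in> I a b" and v: "v \<in> I u p"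
  shows "v \<in> I a b"
proof -
  have vX: "v \<in> X" "u \<in> X" "p \<in> X" using u v p interval_closed by blast+
  have "m a b v \<in> I v (m u v p)"
    using median_greatest[OF vX gate[OF X vX(1) u] gate[OF X vX(1) p]] .
  moreover have "m u v p = v" using v vX by (simp add: interval_iff median_swap23)
  ultimately have "m a b v = v"
    using vX X by (metis interval_iff median_majority median_rotate median_closed)
  then show ?thesis using vX by (simp add: interval_iff)
qed

text \<open>Compare the image \<open>w'\<close> with the median \<open>e\<close> of the three
  images. Convexity puts \<open>e\<close> in \<open>I a b\<close>, so \<open>gate\<close> places
  \<open>w'\<close> between \<open>w\<close> and \<open>e\<close>. Seen from \<open>w'\<close>,
  \<open>e\<close> lies below \<open>c\<close> and \<open>d\<close>, hence below the gate of
  \<open>w'\<close> in \<open>I c d\<close>, which lies between \<open>w'\<close> and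
  \<open>w\<close>. Antisymmetry at \<open>w\<close> gives \<open>w' = e\<close>.\<close>

lemma retraction_interval:
  assumes X: "a \<in> X" "b \<in> X" "c \<in> X" "d \<in> X" and w: "w \<in> I c d"
  shows "m a b w \<in> I (m a b c) (m a b d)"
proof -
  define c' where "c' = m a b c"
  define d' where "d' = m a b d"
  define w' where "w' = m a b w"
  define e where "e = m c' w' d'"
  have wX: "w \<in> X" using w interval_closed by blast
  then have X': "c' \<in> X" "d' \<in> X" "w' \<in> X" "e \<in> X"
    using X by (auto simp: c'_def d'_def w'_def e_def median_closed)
  have ab: "c' \<in> I a b" "d' \<in> I a b" "w' \<in> I a b"
    using X wX median_in_interval unfolding c'_def d'_def w'_def by blast+
  have e: "e \<in> I w' c'" "e \<in> I w' d'" "e \<in> I c' d'"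
    using median_in_interval interval_commute X' unfolding e_def by metis+
  have "c' \<in> I w' c" "d' \<in> I w' d"
    using gate[of a b c w'] gate[of a b d w'] ab X X' interval_commute unfolding c'_def d'_def by metis+
  then have "e \<in> I w' c" "e \<in> I w' d"
    using e interval_trans X X' by blast+
  then have "e \<in> I w' (m c w' d)" using median_greatest X X' by blast
  moreover have "m c d w' = m c w' d" "m c d w' \<in> I w' w"
    using gate[OF X(3,4) X'(3) w] X X' median_swap23 by auto
  ultimately have ew: "e \<in> I w' w"
    using interval_trans wX X' by metis
  have "e \<in> I a b" using interval_convex X ab e by blast
  then have "w' \<in> I w e" using gate X wX w'_def by metis
  then have "w' = e"
    using ew interval_antisym[of w w' e] interval_commute X' wX by metis
  then show ?thesis using e unfolding w'_def c'_def d'_def by simp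
qed

text \<open>The image of a median lies between any two of the three images, which characterizes
  their median.\<close>

lemma median_distrib:
  assumes "a \<in> X" "b \<in> X" "c \<in> X" "d \<in> X" "z \<in> X"
  shows "m a b (m c d z) = m (m a b c) (m a b d) (m a b z)"
  by (rule median_unique) (use assms in \<open>auto intro!: median_closed retraction_interval median_in_interval\<close>)

end

section \<open>Coordinates of the extended action\<close>

text \<open>The preimage of a closed set \<open>C\<close> is the projection of the part of the graph
  over \<open>C\<close>, and projecting along a compact factor is a closed map.\<close>

lemma closed_graph_imp_continuous_map:
  assumes K: "compact_space K" and f: "f \<in> topspace S \<rightarrow> topspace K"
    and graph: "closedin (prod_topology S K) {(p, w). p \<in> topspace S \<and> w = f p}"
  shows "continuous_map S K f"
  unfolding continuous_map_closedin
proof (intro conjI allI impI f)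
  fix C assume C: "closedin K C"
  have "closedin (prod_topology S K) ({(p, w). p \<in> topspace S \<and> w = f p} \<inter> topspace S \<times> C)"
    using graph C by (intro closedin_Int) (auto simp: closedin_prod_Times_iff)
  then have "closedin S (fst ` ({(p, w). p \<in> topspace S \<and> w = f p} \<inter> topspace S \<times> C))"
    using closed_map_fst[OF K] unfolding closed_map_def by blast
  moreover have "fst ` ({(p, w). p \<in> topspace S \<and> w = f p} \<inter> topspace S \<times> C)
      = {p \<in> topspace S. f p \<in> C}"
    by force
  ultimately show "closedin S {p \<in> topspace S. f p \<in> C}" by simp
qed


section \<open>Coordinates of points of the compactification\<close>

context topological_median_algebra
begin

abbreviation "RF \<equiv> rf_compactification T m"

lemma continuous_map_median:
  assumes "continuous_map S T f" "continuous_map S T g" "continuous_map S T h"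
  shows "continuous_map S T (\<lambda>s. m (f s) (g s) (h s))"
proof -
  have "continuous_map S (prod_topology T (prod_topology T T)) (\<lambda>s. (f s, g s, h s))"
    using assms by (intro continuous_map_pairedI)
  from continuous_map_compose[OF this continuous_median] show ?thesis by (simp add: o_def)
qed

lemma rf_embedding_apply: "a \<in> topspace T \<Longrightarrow> b \<in> topspace T \<Longrightarrow> rf_embedding T m z (a, b) = m a b z"
  by (simp add: rf_embedding_def)

lemma topspace_interval_subtopology: "topspace (subtopology T (I a b)) = I a b"
  by (auto simp: median_interval_def)

lemma continuous_map_interval_product_coordinate:
  assumes "a \<in> topspace T" "b \<in> topspace T"
  shows "continuous_map (interval_product T m) (subtopology T (I a b)) (\<lambda>\<xi>. \<xi> (a, b))"
  unfolding interval_product_def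
  using continuous_map_product_projection[of "(a, b)" "topspace T \<times> topspace T"
      "\<lambda>(x, y). subtopology T (I x y)"] assms by simp

lemma continuous_map_rf_coordinate:
  assumes "a \<in> topspace T" "b \<in> topspace T"
  shows "continuous_map RF T (\<lambda>\<xi>. \<xi> (a, b))"
  using continuous_map_interval_product_coordinate[OF assms]
  unfolding rf_compactification_def
  by (simp add: continuous_map_in_subtopology continuous_map_from_subtopology)

lemma rf_coordinate_in_interval:
  assumes "\<xi> \<in> topspace RF" "a \<in> topspace T" "b \<in> topspace T"
  shows "\<xi> (a, b) \<in> I a b"
  using continuous_map_image_subset_topspace[OF continuous_map_interval_product_coordinate[OF assms(2,3)]] assms(1)
  unfolding topspace_interval_subtopology rf_compactification_def by auto

text \<open>For embedded points this is \<open>median_distrib\<close>. Both sides are continuous in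
  \<open>\<xi>\<close> and \<open>T\<close> is Hausdorff, so equality extends to the
  closure.\<close>

lemma rf_median_distrib:
  assumes X: "a \<in> topspace T" "b \<in> topspace T" "c \<in> topspace T" "d \<in> topspace T"
    and \<xi>: "\<xi> \<in> topspace RF"
  shows "m a b (\<xi> (c, d)) = m (m a b c) (m a b d) (\<xi> (a, b))"
proof (rule forall_in_closure_of_eq[where f = "\<lambda>\<xi>. m a b (\<xi> (c, d))"
      and g = "\<lambda>\<xi>. m (m a b c) (m a b d) (\<xi> (a, b))", OF _ hausdorff])
  show "\<xi> \<in> interval_product T m closure_of (rf_embedding T m ` topspace T)"
    using \<xi> unfolding rf_compactification_def by simp
  have coord: "continuous_map (interval_product T m) T (\<lambda>\<xi>. \<xi> (x, y))"
    if "x \<in> topspace T" "y \<in> topspace T" for x y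
    using continuous_map_interval_product_coordinate[OF that] by (simp add: continuous_map_in_subtopology)
  show "continuous_map (interval_product T m) T (\<lambda>\<xi>. m a b (\<xi> (c, d)))"
    and "continuous_map (interval_product T m) T (\<lambda>\<xi>. m (m a b c) (m a b d) (\<xi> (a, b)))"
    using X by (auto intro!: continuous_map_median coord median_closed)
  fix \<zeta> assume "\<zeta> \<in> rf_embedding T m ` topspace T"
  then show "m a b (\<zeta> (c, d)) = m (m a b c) (m a b d) (\<zeta> (a, b))"
    using X by (auto simp: rf_embedding_apply median_distrib)
qed

end

context continuous_median_action
begin

lemma action_closed: "g \<in> carrier G \<Longrightarrow> x \<in> topspace T \<Longrightarrow> \<phi> g x \<in> topspace T"
  by (rule element_image) auto

lemma action_inv:
  assumes "g \<in> carrier G" "x \<in> topspace T"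
  shows "\<phi> g (\<phi> (inv g) x) = x" "\<phi> (inv g) (\<phi> g x) = x"
proof -
  interpret group G using group_hom by (simp add: group_hom_def)
  have "\<phi> \<one> x = x"
    using id_eq_one assms by (metis restrict_apply')
  then show "\<phi> g (\<phi> (inv g) x) = x" "\<phi> (inv g) (\<phi> g x) = x"
    using composition_rule[of x g "inv g"] composition_rule[of x "inv g" g] assms by auto
qed

lemma continuous_map_action:
  assumes "continuous_map S TG f" "continuous_map S T h"
  shows "continuous_map S T (\<lambda>s. \<phi> (f s) (h s))"
  using continuous_map_compose[OF continuous_map_pairedI[OF assms] continuous_action]
  by (simp add: o_def)

end

section \<open>The closed graph of a coordinate of the extended action\<close>

context
  fixes T :: "'a topology" and m :: "'a \<Rightarrow> 'a \<Rightarrow> 'a \<Rightarrow> 'a"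
    and G :: "('g, 'r) monoid_scheme" and TG :: "'g topology" and \<phi> :: "'g \<Rightarrow> 'a \<Rightarrow> 'a"
  assumes tma: "topological_median_algebra T m"
    and tg: "topological_group G TG"
    and act: "continuous_median_action G TG T m \<phi>"
begin

interpretation topological_median_algebra T m by (fact tma)
interpretation topological_group G TG by (fact tg)
interpretation continuous_median_action G TG T m \<phi> by (fact act)

lemma action_in_interval:
  assumes "g \<in> carrier G" "x \<in> topspace T" "y \<in> topspace T" "z \<in> I x y"
  shows "\<phi> g z \<in> I (\<phi> g x) (\<phi> g y)"
  using assms median_equivariant[of g x y z] action_closed unfolding interval_iff by metis

lemma rf_action_coordinate_in_interval:
  assumes g: "g \<in> carrier G" and \<xi>: "\<xi> \<in> topspace RF" and X: "x \<in> topspace T" "y \<in> topspace T"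
  shows "\<phi> g (\<xi> (\<phi> (inv\<^bsub>G\<^esub> g) x, \<phi> (inv\<^bsub>G\<^esub> g) y)) \<in> I x y"
proof -
  have X': "\<phi> (inv\<^bsub>G\<^esub> g) x \<in> topspace T" "\<phi> (inv\<^bsub>G\<^esub> g) y \<in> topspace T"
    using g X by (simp_all add: action_closed)
  show ?thesis
    using action_in_interval[OF g X' rf_coordinate_in_interval[OF \<xi> X']] action_inv g X by simp
qed

text \<open>Replaces a coordinate of \<open>\<xi>\<close> whose index moves with \<open>g\<close> by
  coordinates with fixed indices, where continuity in \<open>g\<close> and \<open>\<xi>\<close>
  jointly is available.\<close>

lemma rf_action_coordinate_eq_iff:
  assumes g: "g \<in> carrier G" and \<xi>: "\<xi> \<in> topspace RF"
    and X: "x \<in> topspace T" "y \<in> topspace T" and w: "w \<in> I x y"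
  shows "w = \<phi> g (\<xi> (\<phi> (inv\<^bsub>G\<^esub> g) x, \<phi> (inv\<^bsub>G\<^esub> g) y)) \<longleftrightarrow>
    (\<forall>a\<in>topspace T. \<forall>b\<in>topspace T.
      m a b (\<phi> (inv\<^bsub>G\<^esub> g) w) = m (m a b (\<phi> (inv\<^bsub>G\<^esub> g) x)) (m a b (\<phi> (inv\<^bsub>G\<^esub> g) y)) (\<xi> (a, b)))"
    (is "_ \<longleftrightarrow> ?R")
proof -
  let ?x = "\<phi> (inv\<^bsub>G\<^esub> g) x" and ?y = "\<phi> (inv\<^bsub>G\<^esub> g) y" and ?w = "\<phi> (inv\<^bsub>G\<^esub> g) w"
  have X': "?x \<in> topspace T" "?y \<in> topspace T"
    using g X by (simp_all add: action_closed)
  have \<xi>I: "\<xi> (?x, ?y) \<in> I ?x ?y" and wI: "?w \<in> I ?x ?y"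
    using rf_coordinate_in_interval[OF \<xi> X'] action_in_interval X w g by auto
  have "w = \<phi> g (\<xi> (?x, ?y)) \<longleftrightarrow> ?w = \<xi> (?x, ?y)"
    using action_inv g \<xi>I w interval_closed by metis
  also have "\<dots> \<longleftrightarrow> ?R"
  proof
    assume "?w = \<xi> (?x, ?y)"
    then show ?R using rf_median_distrib \<xi> X' by simp
  next
    assume ?R
    \<comment> \<open>Take \<open>a = ?x\<close> and \<open>b = ?y\<close>: this retraction fixes
      both endpoints and every point of \<open>I ?x ?y\<close>.\<close>
    then have "m ?x ?y ?w = m (m ?x ?y ?x) (m ?x ?y ?y) (\<xi> (?x, ?y))" using X' by blast
    moreover have "m ?x ?y ?x = ?x" "m ?x ?y ?y = ?y"
      using X' by (metis median_majority median_rotate)+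
    ultimately show "?w = \<xi> (?x, ?y)" using \<xi>I wI by (simp add: interval_iff)
  qed
  finally show ?thesis .
qed

lemma continuous_map_rf_action_coordinate:
  assumes K: "compactin T (I x y)" and X: "x \<in> topspace T" "y \<in> topspace T"
  shows "continuous_map (prod_topology TG RF) (subtopology T (I x y))
    (\<lambda>(g, \<xi>). \<phi> g (\<xi> (\<phi> (inv\<^bsub>G\<^esub> g) x, \<phi> (inv\<^bsub>G\<^esub> g) y)))"
    (is "continuous_map ?S ?K ?f")
proof (rule closed_graph_imp_continuous_map)
  show "compact_space ?K" using K by (rule compact_space_subtopology)
  show "?f \<in> topspace ?S \<rightarrow> topspace ?K"
    using rf_action_coordinate_in_interval X
    by (auto simp: topspace_group topspace_interval_subtopology simp del: topspace_subtopology)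
  let ?P = "prod_topology ?S ?K"
  \<comment> \<open>The condition of \<open>rf_action_coordinate_eq_iff\<close> for one pair
    \<open>(a, b)\<close>; as the pair does not depend on \<open>g\<close>, both sides are
    continuous on \<open>?P\<close>.\<close>
  define E where "E a b = {s \<in> topspace ?P. case s of ((g, \<xi>), w) \<Rightarrow>
      m a b (\<phi> (inv\<^bsub>G\<^esub> g) w) = m (m a b (\<phi> (inv\<^bsub>G\<^esub> g) x)) (m a b (\<phi> (inv\<^bsub>G\<^esub> g) y)) (\<xi> (a, b))}" for a b
  have E: "closedin ?P (E a b)" if ab: "a \<in> topspace T" "b \<in> topspace T" for a b
  proof -
    have g: "continuous_map ?P TG (\<lambda>s. inv\<^bsub>G\<^esub> (fst (fst s)))"
      using continuous_map_compose[OF continuous_map_compose[OF continuous_map_fst continuous_map_fst] continuous_inv]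
      by (simp add: o_def)
    have w: "continuous_map ?P T snd"
      using continuous_map_snd[of ?S ?K] by (simp add: continuous_map_in_subtopology)
    have \<xi>: "continuous_map ?P T (\<lambda>s. snd (fst s) (a, b))"
      using continuous_map_compose[OF continuous_map_compose[OF continuous_map_fst continuous_map_snd] continuous_map_rf_coordinate[OF ab]]
      by (simp add: o_def)
    have "closedin ?P {s \<in> topspace ?P. m a b (\<phi> (inv\<^bsub>G\<^esub> (fst (fst s))) (snd s)) =
        m (m a b (\<phi> (inv\<^bsub>G\<^esub> (fst (fst s))) x)) (m a b (\<phi> (inv\<^bsub>G\<^esub> (fst (fst s))) y)) (snd (fst s) (a, b))}"
      by (rule closedin_continuous_maps_eq[OF hausdorff];
          intro continuous_map_median continuous_map_action g w \<xi>) (use ab X in auto)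
    then show ?thesis unfolding E_def by (simp add: case_prod_beta)
  qed
  have "{(p, w). p \<in> topspace ?S \<and> w = ?f p} = (\<Inter>(a, b)\<in>topspace T \<times> topspace T. E a b)"
    (is "?L = ?R")
  proof (rule Set.set_eqI)
    fix s :: "('g \<times> ('a \<times> 'a \<Rightarrow> 'a)) \<times> 'a"
    obtain g \<xi> w where s: "s = ((g, \<xi>), w)" by (metis surj_pair)
    have "s \<in> ?L \<longleftrightarrow> g \<in> carrier G \<and> \<xi> \<in> topspace RF \<and> w \<in> I x y
        \<and> w = \<phi> g (\<xi> (\<phi> (inv\<^bsub>G\<^esub> g) x, \<phi> (inv\<^bsub>G\<^esub> g) y))"
      using rf_action_coordinate_in_interval X by (auto simp: s topspace_group)
    also have "\<dots> \<longleftrightarrow> g \<in> carrier G \<and> \<xi> \<in> topspace RF \<and> w \<in> I x y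
        \<and> (\<forall>a\<in>topspace T. \<forall>b\<in>topspace T.
          m a b (\<phi> (inv\<^bsub>G\<^esub> g) w) = m (m a b (\<phi> (inv\<^bsub>G\<^esub> g) x)) (m a b (\<phi> (inv\<^bsub>G\<^esub> g) y)) (\<xi> (a, b)))"
      using rf_action_coordinate_eq_iff[OF _ _ X] by blast
    also have "\<dots> \<longleftrightarrow> s \<in> ?R"
      using X by (auto simp: s E_def topspace_group topspace_interval_subtopology simp del: topspace_subtopology)
    finally show "s \<in> ?L \<longleftrightarrow> s \<in> ?R" .
  qed
  \<comment> \<open>The family is nonempty because \<open>(x, y)\<close> is one of its
    indices.\<close>
  also have "closedin ?P \<dots>"
    using E X by (intro closedin_INT) auto
  finally show "closedin ?P {(p, w). p \<in> topspace ?S \<and> w = ?f p}" .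
qed

end

theorem proposition5p5:
  fixes T :: "'a topology" and m :: "'a \<Rightarrow> 'a \<Rightarrow> 'a \<Rightarrow> 'a"
    and G :: "('g, 'r) monoid_scheme" and TG :: "'g topology" and \<phi> :: "'g \<Rightarrow> 'a \<Rightarrow> 'a"
  assumes "topological_median_algebra T m"
    and "has_compact_intervals T m"
    and "topological_group G TG"
    and "continuous_median_action G TG T m \<phi>"
  shows "continuous_map (prod_topology TG (rf_compactification T m)) (rf_compactification T m)
           (\<lambda>(g, \<xi>). rf_action G T m \<phi> g \<xi>)"
proof -
  let ?S = "prod_topology TG (rf_compactification T m)"
  let ?f = "\<lambda>(g, \<xi>). rf_action G T m \<phi> g \<xi>"
  have tg: "topspace TG = carrier G"
    using assms(3) by (simp add: topological_group_def topological_group_axioms_def)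
  have eq: "rf_action G T m \<phi> g \<xi> = restrict (\<lambda>(x, y). \<phi> g (\<xi> (\<phi> (inv\<^bsub>G\<^esub> g) x, \<phi> (inv\<^bsub>G\<^esub> g) y)))
         (topspace T \<times> topspace T)" if "\<xi> \<in> topspace (rf_compactification T m)" for g \<xi>
    using that by (simp add: rf_action_def)
  have "continuous_map ?S (subtopology T (median_interval (topspace T) m x y)) (\<lambda>s. ?f s (x, y))"
    if X: "x \<in> topspace T" "y \<in> topspace T" for x y
    using assms(2) X unfolding has_compact_intervals_def
    by (intro continuous_map_eq[OF continuous_map_rf_action_coordinate[OF assms(1,3,4) _ X]])
      (auto simp: eq)
  moreover have "?f ` topspace ?S \<subseteq> extensional (topspace T \<times> topspace T)"
    by (auto simp: eq)
  ultimately have "continuous_map ?S (interval_product T m) ?f"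
    unfolding interval_product_def continuous_map_componentwise by auto
  \<comment> \<open>Continuity into the full product is settled; the values stay in the closure
    because each group element maps the compactification onto itself.\<close>
  moreover have "?f s \<in> topspace (rf_compactification T m)" if "s \<in> topspace ?S" for s
    using that homeomorphic_imp_surjective_map[OF homeomorphic_map_rf_action[OF assms(1,3,4)]]
    by (auto simp: tg)
  ultimately show ?thesis
    unfolding rf_compactification_def by (auto simp: continuous_map_in_subtopology)
qed

end
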